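(* Let $f$ be a function for which the conventional improper integral $\int_a^\infty f(x)\,dx=\lim_{b\to\infty}\int_a^b f(x)\,dx$ exists. Then the generalized integral of $f$ over $[a,\infty)$ satisfies $$\mathrm{Z}\!\!\int_a^\infty f(x)\,dx=\int_a^\infty f(x)\,dx .$$
   Context: A termination function is a function $z:\mathbb{R}\to\mathbb{R}$ for which there is a finite constant $c>0$ such that $z(x)=1$ for $x\le 0$, $z(x)=0$ for $x\ge c$, $z'(x)\le 0$, and $\int_{-\infty}^{\infty} z'(x)\,dx=\int_0^c z'(x)\,dx=-1$. So $z$ is nonincreasing from $1$ to $0$. Jumps of $z$ are allowed, with $z'$ understood in the generalized sense (a jump contributes a Dirac delta, and integrals $\int_0^c\cdots z'(x)\,dx$ include point masses at the endpoints). The function $z$ does not depend on the limit variable $b$ below. The generalized integral of $f$ over $[a,\infty)$ with respect to $z$ is $$\lim_{b\to\infty}\left\{\int_a^b f(x)\,dx+\int_b^{b+c} f(x)\,z(x-b)\,dx\right\}.$$ It is said to exist with respect to $z$ when the (conventional, e.g. Riemann) integrals and the limit exist. The generalized integral $\mathrm{Z}\!\!\int_a^\infty f(x)\,dx$ is said to exist if the limit exists for some termination function $z$ and has the same value for all termination functions for which it exists; that common value is the value of the integral. *)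

theory Defs
  imports "HOL-Analysis.Analysis"
begin

definition test_function :: "(real \<Rightarrow> real) \<Rightarrow> bool" where
  "test_function \<phi> \<longleftrightarrow>
     (\<forall>n. (deriv ^^ n) \<phi> differentiable_on UNIV) \<and> (\<exists>R. \<forall>x. R < \<bar>x\<bar> \<longrightarrow> \<phi> x = 0)"

text \<open>
  The distributional derivative of \<open>z\<close> is the negative of the measure \<open>\<mu>\<close>, i.e.
  \<open>z' = - \<mu>\<close>. As \<open>\<mu>\<close> is a positive measure, this includes \<open>z' \<le> 0\<close>;
  a downward jump of \<open>z\<close> is a point mass of \<open>\<mu>\<close>.
\<close>

definition has_neg_derivative_measure :: "(real \<Rightarrow> real) \<Rightarrow> real measure \<Rightarrow> bool" where
  "has_neg_derivative_measure z \<mu> \<longleftrightarrow>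
     sets \<mu> = sets borel \<and>
     (\<forall>K. compact K \<longrightarrow> emeasure \<mu> K < \<infinity>) \<and>
     (\<forall>\<phi>. test_function \<phi> \<longrightarrow>
        (LINT x|lborel. z x * deriv \<phi> x) = (LINT x|\<mu>. \<phi> x))"

text \<open>
  The distributional derivative does not see the values of \<open>z\<close> on null sets, so that \<open>z\<close> is
  pointwise nonincreasing is required in addition; the value at a jump may be anything between
  the one-sided limits. The closed interval \<open>{0..c}\<close> includes point masses at its endpoints.
\<close>

definition termination_function_on :: "real \<Rightarrow> (real \<Rightarrow> real) \<Rightarrow> bool" where
  "termination_function_on c z \<longleftrightarrow>
     c > 0 \<and> (\<forall>x\<le>0. z x = 1) \<and> (\<forall>x\<ge>c. z x = 0) \<and> antimono z \<and>
     (\<exists>\<mu>. has_neg_derivative_measure z \<mu> \<and> emeasure \<mu> UNIV = 1 \<and> emeasure \<mu> {0..c} = 1)"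

definition termination_function :: "(real \<Rightarrow> real) \<Rightarrow> bool" where
  "termination_function z \<longleftrightarrow> (\<exists>c. termination_function_on c z)"

text \<open>
  The constant \<open>c\<close> of a termination function is not unique, but the integral below does not
  depend on its choice, as \<open>z\<close> vanishes on \<open>{c..}\<close>. The integrals over bounded intervals are
  Henstock-Kurzweil integrals, which extend the Riemann (and Lebesgue) integral. The codomain
  covers real- and complex-valued functions.
\<close>

definition has_Z_integral_wrt ::
  "(real \<Rightarrow> real) \<Rightarrow> (real \<Rightarrow> 'a::euclidean_space) \<Rightarrow> real \<Rightarrow> 'a \<Rightarrow> bool" where
  "has_Z_integral_wrt z f a I \<longleftrightarrow>
     (\<exists>c. termination_function_on c z \<and>
        (\<forall>b\<ge>a. f integrable_on {a..b} \<and> (\<lambda>x. z (x - b) *\<^sub>R f x) integrable_on {b..b + c}) \<and>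
        ((\<lambda>b. integral {a..b} f + integral {b..b + c} (\<lambda>x. z (x - b) *\<^sub>R f x)) \<longlongrightarrow> I) at_top)"

definition has_Z_integral :: "(real \<Rightarrow> 'a::euclidean_space) \<Rightarrow> real \<Rightarrow> 'a \<Rightarrow> bool" where
  "has_Z_integral f a I \<longleftrightarrow>
     (\<exists>z. termination_function z \<and> has_Z_integral_wrt z f a I) \<and>
     (\<forall>z J. termination_function z \<and> has_Z_integral_wrt z f a J \<longrightarrow> J = I)"

definition Z_integrable :: "(real \<Rightarrow> 'a::euclidean_space) \<Rightarrow> real \<Rightarrow> bool" where
  "Z_integrable f a \<longleftrightarrow> (\<exists>I. has_Z_integral f a I)"

definition Z_integral :: "(real \<Rightarrow> 'a::euclidean_space) \<Rightarrow> real \<Rightarrow> 'a" where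
  "Z_integral f a = (THE I. has_Z_integral f a I)"

definition improper_integrable :: "(real \<Rightarrow> 'a::euclidean_space) \<Rightarrow> real \<Rightarrow> bool" where
  "improper_integrable f a \<longleftrightarrow>
     (\<forall>b\<ge>a. f integrable_on {a..b}) \<and> (\<exists>I. ((\<lambda>b. integral {a..b} f) \<longlongrightarrow> I) at_top)"

definition improper_integral :: "(real \<Rightarrow> 'a::euclidean_space) \<Rightarrow> real \<Rightarrow> 'a" where
  "improper_integral f a = Lim at_top (\<lambda>b. integral {a..b} f)"

end

theory Submission
  imports Defs "HOL-Probability.Giry_Monad"
begin

text \<open>
  Write \<open>F b\<close> for the integral of \<open>f\<close> over \<open>{a..b}\<close>. A termination function decreases from \<open>1\<close> at
  \<open>0\<close> to \<open>0\<close> at \<open>c\<close>, so the second mean value theorem, applied to each component \<open>f\<^sub>i\<close>, shows that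
  \<open>z (x - b) f\<^sub>i x\<close> is integrable over \<open>{b..b + c}\<close>, with integral equal to that of \<open>f\<^sub>i\<close> over
  \<open>{b..\<xi>}\<close> for some \<open>\<xi> \<ge> b\<close>. Hence the \<open>i\<close>-th component of the expression whose limit defines the
  generalized integral is \<open>F\<^sub>i \<xi>\<close>, and as \<open>\<xi> \<ge> b\<close> it has the same limit as \<open>F\<^sub>i b\<close>. So every
  termination function gives the value of the improper integral
  (\<open>termination_function_tendsto_improper_integral\<close>).

  It remains to exhibit one termination function. The indicator of \<open>{..0}\<close> serves: its
  negative derivative is the Dirac measure at \<open>0\<close> (\<open>termination_function_on_indicator\<close>).
\<close>

lemma test_functionD:
  assumes "test_function \<phi>"
  shows "(\<phi> has_real_derivative deriv \<phi> x) (at x)" "isCont (deriv \<phi>) x"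
proof -
  have "(deriv ^^ n) \<phi> differentiable_on UNIV" for n
    using assms by (simp add: test_function_def)
  from this[of 0] this[of 1] have "\<phi> differentiable at x" "deriv \<phi> differentiable at x"
    by (simp_all add: differentiable_on_def)
  then show "(\<phi> has_real_derivative deriv \<phi> x) (at x)" "isCont (deriv \<phi>) x"
    by (simp_all add: DERIV_deriv_iff_real_differentiable differentiable_imp_continuous_within)
qed

lemma integral_indicator_deriv_test_function:
  assumes "test_function \<phi>"
  shows "(LINT x|lborel. indicator {..0} x * deriv \<phi> x) = \<phi> 0"
proof -
  obtain R where R: "\<And>x. R < \<bar>x\<bar> \<Longrightarrow> \<phi> x = 0"
    using assms by (auto simp: test_function_def)
  define S where "S = max R 0 + 1"
  have deriv0: "deriv \<phi> x = 0" if "x < - S" for x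
  proof -
    have "eventually (\<lambda>y. y \<in> {..<- S}) (nhds x)"
      using that by (intro eventually_nhds_in_open) auto
    then have "eventually (\<lambda>y. \<phi> y = 0) (nhds x)"
      by eventually_elim (auto intro!: R simp: S_def)
    then have "deriv \<phi> x = deriv (\<lambda>_. 0) x"
      by (rule deriv_cong_ev) simp
    then show ?thesis by simp
  qed
  have "(LINT x|lborel. indicator {..0} x * deriv \<phi> x)
      = (LINT x|lborel. deriv \<phi> x * indicator {- S..0} x)"
    by (intro Bochner_Integration.integral_cong refl) (auto simp: indicator_def deriv0)
  also have "\<dots> = \<phi> 0 - \<phi> (- S)"
    by (rule integral_FTC_Icc_real) (auto simp: test_functionD[OF assms] S_def)
  also have "\<phi> (- S) = 0"
    by (rule R) (auto simp: S_def)
  finally show ?thesis by simp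
qed

lemma termination_function_on_indicator:
  assumes "c > 0"
  shows "termination_function_on c (indicator {..0})"
proof -
  have "has_neg_derivative_measure (indicator {..0}) (return borel 0)"
    unfolding has_neg_derivative_measure_def
  proof (intro conjI allI impI)
    fix \<phi> :: "real \<Rightarrow> real"
    assume \<phi>: "test_function \<phi>"
    have "continuous_on UNIV \<phi>"
      using test_functionD(1)[OF \<phi>] by (meson DERIV_isCont continuous_at_imp_continuous_on)
    then have "\<phi> \<in> borel_measurable borel"
      by (rule borel_measurable_continuous_onI)
    then show "(LINT x|lborel. indicator {..0} x * deriv \<phi> x) = (LINT x|return borel 0. \<phi> x)"
      by (simp add: integral_return integral_indicator_deriv_test_function[OF \<phi>])
  qed (auto simp: compact_imp_closed indicator_def)
  moreover have "antimono (indicator {..0} :: real \<Rightarrow> real)"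
    by (auto simp: antimono_def indicator_def)
  moreover have "emeasure (return borel (0::real)) UNIV = 1"
      "emeasure (return borel (0::real)) {0..c} = 1"
    using assms by simp_all
  ultimately show ?thesis
    using assms unfolding termination_function_on_def by (auto simp: indicator_def)
qed

text \<open>
  The second mean value theorem for a nonincreasing weight that falls from \<open>1\<close> to \<open>0\<close>; the
  intermediate point depends on the component \<open>i\<close>.
\<close>

lemma has_integral_termination_component:
  fixes f :: "real \<Rightarrow> 'a::euclidean_space"
  assumes "termination_function_on c z" and f: "f integrable_on {b..b + c}"
  obtains \<xi> where "\<xi> \<ge> b"
    "((\<lambda>x. z (x - b) *\<^sub>R f x \<bullet> i) has_integral integral {b..\<xi>} f \<bullet> i) {b..b + c}"
proof -
  have z: "c > 0" "z 0 = 1" "z c = 0" "antimono z"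
    using assms(1) by (auto simp: termination_function_on_def)
  \<comment> \<open>The mean value theorem is stated for nondecreasing weights, hence the sign.\<close>
  obtain \<xi> where \<xi>: "\<xi> \<in> {b..b + c}"
    and int: "((\<lambda>x. - z (x - b) * (f x \<bullet> i)) has_integral
      - z (b - b) * integral {b..\<xi>} (\<lambda>x. f x \<bullet> i)
        + - z (b + c - b) * integral {\<xi>..b + c} (\<lambda>x. f x \<bullet> i)) {b..b + c}"
    using z(1) integrable_component[OF f, of i]
    by (rule_tac second_mean_value_theorem_full[of "\<lambda>x. f x \<bullet> i" b "b + c" "\<lambda>x. - z (x - b)"])
      (auto intro!: antimonoD[OF z(4)])
  have "f integrable_on {b..\<xi>}"
    using f \<xi> by (rule_tac integrable_on_subinterval) auto
  then have "((\<lambda>x. z (x - b) *\<^sub>R f x \<bullet> i) has_integral integral {b..\<xi>} f \<bullet> i) {b..b + c}"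
    using has_integral_neg[OF int] z by simp
  then show thesis
    using \<xi> that by auto
qed

lemma termination_function_tendsto_improper_integral:
  fixes f :: "real \<Rightarrow> 'a::euclidean_space"
  assumes z: "termination_function_on c z"
    and f: "\<And>b. b \<ge> a \<Longrightarrow> f integrable_on {a..b}"
    and lim: "((\<lambda>b. integral {a..b} f) \<longlongrightarrow> I) at_top"
  shows "\<And>b. b \<ge> a \<Longrightarrow> (\<lambda>x. z (x - b) *\<^sub>R f x) integrable_on {b..b + c}"
    and "((\<lambda>b. integral {a..b} f + integral {b..b + c} (\<lambda>x. z (x - b) *\<^sub>R f x)) \<longlongrightarrow> I) at_top"
proof -
  have c: "c > 0"
    using z by (simp add: termination_function_on_def)
  have "\<exists>\<xi>\<ge>b. ((\<lambda>x. z (x - b) *\<^sub>R f x \<bullet> i) has_integral integral {b..\<xi>} f \<bullet> i) {b..b + c}"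
    if b: "b \<ge> a" for b i
  proof -
    have "f integrable_on {b..b + c}"
      using f[of "b + c"] b c by (rule_tac integrable_on_subinterval) auto
    from has_integral_termination_component[OF z this] show ?thesis
      by metis
  qed
  then obtain \<xi> where \<xi>: "\<And>b i. b \<ge> a \<Longrightarrow> \<xi> b i \<ge> b"
    and int: "\<And>b i. b \<ge> a \<Longrightarrow>
      ((\<lambda>x. z (x - b) *\<^sub>R f x \<bullet> i) has_integral integral {b..\<xi> b i} f \<bullet> i) {b..b + c}"
    by metis
  show integrable: "(\<lambda>x. z (x - b) *\<^sub>R f x) integrable_on {b..b + c}" if "b \<ge> a" for b
    by (rule integrable_componentwise, rule has_integral_integrable, rule int[OF that])
  have comp: "(integral {a..b} f + integral {b..b + c} (\<lambda>x. z (x - b) *\<^sub>R f x)) \<bullet> i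
      = integral {a..\<xi> b i} f \<bullet> i" if b: "b \<ge> a" for b i
  proof -
    have "integral {b..b + c} (\<lambda>x. z (x - b) *\<^sub>R f x) \<bullet> i = integral {b..\<xi> b i} f \<bullet> i"
      unfolding integral_component_eq[OF integrable[OF b], symmetric]
      by (rule integral_unique[OF int[OF b]])
    then have "(integral {a..b} f + integral {b..b + c} (\<lambda>x. z (x - b) *\<^sub>R f x)) \<bullet> i
        = (integral {a..b} f + integral {b..\<xi> b i} f) \<bullet> i"
      by (simp only: inner_add_left)
    also have "integral {a..b} f + integral {b..\<xi> b i} f = integral {a..\<xi> b i} f"
    proof (rule Henstock_Kurzweil_Integration.integral_combine)
      show "f integrable_on {a..\<xi> b i}"
        using \<xi>[OF b, of i] b by (intro f) simp
    qed (fact b, rule \<xi>[OF b])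
    finally show ?thesis .
  qed
  show "((\<lambda>b. integral {a..b} f + integral {b..b + c} (\<lambda>x. z (x - b) *\<^sub>R f x)) \<longlongrightarrow> I) at_top"
  proof (subst tendsto_componentwise_iff, intro ballI)
    fix i :: 'a
    have "eventually (\<lambda>b. b \<le> \<xi> b i) at_top"
      using eventually_ge_at_top[of a] by (rule eventually_mono) (rule \<xi>)
    then have "filterlim (\<lambda>b. \<xi> b i) at_top at_top"
      by (rule filterlim_at_top_mono[OF filterlim_ident])
    then have "((\<lambda>b. integral {a..\<xi> b i} f \<bullet> i) \<longlongrightarrow> I \<bullet> i) at_top"
      by (intro tendsto_inner filterlim_compose[OF lim] tendsto_const)
    then show "((\<lambda>b. (integral {a..b} f + integral {b..b + c} (\<lambda>x. z (x - b) *\<^sub>R f x)) \<bullet> i)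
        \<longlongrightarrow> I \<bullet> i) at_top"
    proof (rule Lim_transform_eventually)
      show "eventually (\<lambda>b. integral {a..\<xi> b i} f \<bullet> i
          = (integral {a..b} f + integral {b..b + c} (\<lambda>x. z (x - b) *\<^sub>R f x)) \<bullet> i) at_top"
        using eventually_ge_at_top[of a] by (rule eventually_mono) (rule comp[symmetric])
    qed
  qed
qed

lemma has_Z_integral_improper_limit:
  fixes f :: "real \<Rightarrow> 'a::euclidean_space"
  assumes f: "\<And>b. b \<ge> a \<Longrightarrow> f integrable_on {a..b}"
    and lim: "((\<lambda>b. integral {a..b} f) \<longlongrightarrow> I) at_top"
  shows "has_Z_integral f a I"
  unfolding has_Z_integral_def
proof (intro conjI allI impI)
  have step: "termination_function_on 1 (indicator {..0})"
    by (rule termination_function_on_indicator) simp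
  have "has_Z_integral_wrt (indicator {..0}) f a I"
    using termination_function_tendsto_improper_integral[OF step f lim] step f
    unfolding has_Z_integral_wrt_def by blast
  with step show "\<exists>z. termination_function z \<and> has_Z_integral_wrt z f a I"
    unfolding termination_function_def by blast
next
  fix z J
  assume "termination_function z \<and> has_Z_integral_wrt z f a J"
  then obtain c where z: "termination_function_on c z"
    and J: "((\<lambda>b. integral {a..b} f + integral {b..b + c} (\<lambda>x. z (x - b) *\<^sub>R f x)) \<longlongrightarrow> J) at_top"
    unfolding has_Z_integral_wrt_def by blast
  show "J = I"
    using J termination_function_tendsto_improper_integral(2)[OF z f lim]
    by (rule tendsto_unique[OF trivial_limit_at_top_linorder])
qed

theorem lemma2:
  fixes f :: "real \<Rightarrow> 'a::euclidean_space" and a :: real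
  assumes "improper_integrable f a"
  shows "Z_integrable f a \<and> Z_integral f a = improper_integral f a"
proof -
  obtain I where f: "\<And>b. b \<ge> a \<Longrightarrow> f integrable_on {a..b}"
    and lim: "((\<lambda>b. integral {a..b} f) \<longlongrightarrow> I) at_top"
    using assms unfolding improper_integrable_def by blast
  have I: "has_Z_integral f a I"
    by (rule has_Z_integral_improper_limit[OF f lim])
  have "Z_integral f a = I"
    unfolding Z_integral_def
  proof (rule the_equality)
    show "has_Z_integral f a I" by (rule I)
    show "J = I" if "has_Z_integral f a J" for J
      using I that unfolding has_Z_integral_def by blast
  qed
  moreover have "improper_integral f a = I"
    unfolding improper_integral_def
    using lim by (rule tendsto_Lim[OF trivial_limit_at_top_linorder])
  ultimately show ?thesis
    using I unfolding Z_integrable_def by auto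
qed

end
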